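(* Let $a\in\mathbb{R}^d$ be strictly, symmetrically decreasing and collision-free in frequency, let $\phi_1,\phi_2\in\mathbb{R}^d$ be pointwise independent (in the frequency domain), and let $x\in\mathbb{R}^d$ satisfy $\operatorname{Re}[\overline{\hat x_k}\,\hat\phi_{i,k}]\neq0$ for $k=-\lfloor (d-1)/2\rfloor,\dots,\lfloor d/2\rfloor$ and $i=1,2$. Then $a$ and $x$ can be recovered from the samples $$\bigl\{|\langle x,(\operatorname{circ}a)^\ell\phi_1\rangle|,\ |\langle x,(\operatorname{circ}a)^\ell\phi_2\rangle|\bigr\}_{\ell=0}^{L-1}\quad\text{with}\quad L:=\bigl(\lfloor \tfrac d2\rfloor+1\bigr)\bigl(\lfloor\tfrac d2\rfloor+2\bigr)$$ up to global sign. That is, if $(a,x)$ and $(a',x')$ both satisfy these hypotheses (with the same known $\phi_1,\phi_2$) and yield the same samples for $i=1,2$ and $\ell=0,\dots,L-1$, then $a'=a$ and $x'=\pm x$.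
   Context: $\hat v=Fv$ denotes the discrete Fourier transform of $v\in\mathbb{C}^d$, $F=(e^{-2\pi i jk/d})_{j,k=0}^{d-1}$; indices of vectors are taken modulo $d$; $\hat\phi_{i,k}$ is the $k$th component of $\hat\phi_i$. $\operatorname{circ}a$ is the circulant matrix with first column $a$ (cyclic convolution with $a$). The kernel $a$ is strictly, symmetrically decreasing if all $\hat a_k$ are real and positive, $\hat a_k=\hat a_{-k}$ for all $k$, and $\hat a_k>\hat a_j$ for all $k,j\in\{0,\dots,\lfloor d/2\rfloor\}$ with $k<j$. It is collision-free in frequency if the products $\hat a_j\hat a_k$ with $j,k\in\{0,\dots,\lfloor d/2\rfloor\}$, $j\ge k$, are pairwise distinct. The vectors $\phi_1,\phi_2$ are pointwise independent (in the frequency domain) if, for each $k=1,\dots,\lfloor (d-1)/2\rfloor$, the complex numbers $\hat\phi_{1,k}$ and $\hat\phi_{2,k}$, interpreted as vectors in $\mathbb{R}^2$, are linearly independent. *)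

theory Defs
  imports Complex_Main "Jordan_Normal_Form.Matrix"
begin

definition dft_mat :: "nat \<Rightarrow> complex mat" where
  "dft_mat d = mat d d (\<lambda>(j, k). exp (- 2 * of_real pi * \<i> * of_nat j * of_nat k / of_nat d))"

definition dft :: "complex vec \<Rightarrow> complex vec" where
  "dft v = dft_mat (dim_vec v) *\<^sub>v v"

(* The k-th Fourier component of a real vector; the index k is an integer read modulo the dimension. *)
definition fourier_coeff :: "real vec \<Rightarrow> int \<Rightarrow> complex" where
  "fourier_coeff v k = dft (map_vec complex_of_real v) $ nat (k mod int (dim_vec v))"

definition circ :: "real vec \<Rightarrow> real mat" where
  "circ a = mat (dim_vec a) (dim_vec a)
     (\<lambda>(i, j). a $ nat ((int i - int j) mod int (dim_vec a)))"

definition strictly_symmetrically_decreasing :: "real vec \<Rightarrow> bool" where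
  "strictly_symmetrically_decreasing a \<longleftrightarrow>
     (\<forall>k. fourier_coeff a k \<in> \<real> \<and> Re (fourier_coeff a k) > 0) \<and>
     (\<forall>k. fourier_coeff a k = fourier_coeff a (- k)) \<and>
     (\<forall>k\<in>{0..int (dim_vec a div 2)}. \<forall>j\<in>{0..int (dim_vec a div 2)}.
        k < j \<longrightarrow> Re (fourier_coeff a k) > Re (fourier_coeff a j))"

definition collision_free_in_frequency :: "real vec \<Rightarrow> bool" where
  "collision_free_in_frequency a \<longleftrightarrow>
     inj_on (\<lambda>(j, k). fourier_coeff a j * fourier_coeff a k)
       {(j, k). j \<in> {0..int (dim_vec a div 2)} \<and> k \<in> {0..int (dim_vec a div 2)} \<and> j \<ge> k}"

(* Real linear independence of a pair: the condition that the two numbers differ is needed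
   because independence is a predicate on sets, and {z, z} collapses to {z}. *)
definition pointwise_independent :: "nat \<Rightarrow> real vec \<Rightarrow> real vec \<Rightarrow> bool" where
  "pointwise_independent d \<phi>1 \<phi>2 \<longleftrightarrow>
     (\<forall>k\<in>{1..int ((d - 1) div 2)}.
        fourier_coeff \<phi>1 k \<noteq> fourier_coeff \<phi>2 k \<and>
        independent {fourier_coeff \<phi>1 k, fourier_coeff \<phi>2 k})"

end

theory Submission imports Defs "HOL-Computational_Algebra.Polynomial" begin

text \<open>In frequency, the samples for one \<open>\<phi>\<close> are absolute values of an exponential sum
  \<open>\<Sum>k\<le>n. c k * \<alpha> k ^ l\<close> with \<open>n = d div 2\<close>, where \<open>\<alpha>\<close> is half of the spectrum of \<open>a\<close> and
  \<open>c k\<close> is a positive multiple of the real part of the conjugate of the \<open>k\<close>-th frequency of \<open>x\<close>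
  times that of \<open>\<phi>\<close>. Its square is an exponential sum in the \<open>(n + 1) * (n + 2) div 2\<close> distinct
  products \<open>\<alpha> j * \<alpha> k\<close>, with nonzero coefficients, so twice as many samples determine the products
  and the coefficients (the difference of two such sums vanishes by a Vandermonde argument). The
  set of products determines the decreasing sequence \<open>\<alpha>\<close>, and the coefficients determine \<open>c\<close> up to
  a sign. The signs for \<open>\<phi>1\<close> and \<open>\<phi>2\<close> agree because both can be read off at frequency 0, where
  everything is real. The same argument gives frequency \<open>d div 2\<close> of \<open>x\<close> if \<open>d\<close> is even, and
  pointwise independence gives the remaining ones.\<close>

subsection \<open>Squares of exponential sums\<close>

text \<open>Vandermonde argument: by linearity, every polynomial of degree below
  \<open>card S\<close> pairs to zero with \<open>f\<close>. The product of the linear factors at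
  the other points of \<open>S\<close> isolates the value at \<open>s\<close>.\<close>

lemma power_sums_zero_imp_coeffs_zero:
  fixes f :: "'a::field \<Rightarrow> 'a"
  assumes "finite S" and zero: "\<And>l. l < card S \<Longrightarrow> (\<Sum>p\<in>S. f p * p ^ l) = 0" and "s \<in> S"
  shows "f s = 0"
proof -
  define q where "q = (\<Prod>r\<in>S - {s}. [:- r, 1:])"
  have "degree q \<le> (\<Sum>r\<in>S - {s}. degree [:- r, 1:])"
    unfolding q_def using \<open>finite S\<close> by (intro degree_prod_sum_le[unfolded o_def]) auto
  then have deg: "degree q < card S"
    using \<open>finite S\<close> \<open>s \<in> S\<close> card_gt_0_iff[of S] by auto
  have "f s * poly q s = (\<Sum>p\<in>S. f p * poly q p)"
  proof (subst sum.remove[OF \<open>finite S\<close> \<open>s \<in> S\<close>])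
    have "(\<Sum>p\<in>S - {s}. f p * poly q p) = 0"
      by (rule sum.neutral) (auto simp: q_def poly_prod \<open>finite S\<close> prod_zero_iff)
    then show "f s * poly q s = f s * poly q s + (\<Sum>p\<in>S - {s}. f p * poly q p)"
      by simp
  qed
  also have "\<dots> = (\<Sum>p\<in>S. \<Sum>l\<le>degree q. coeff q l * (f p * p ^ l))"
    by (simp add: poly_altdef sum_distrib_left mult_ac)
  also have "\<dots> = (\<Sum>l\<le>degree q. coeff q l * (\<Sum>p\<in>S. f p * p ^ l))"
    by (subst sum.swap) (simp add: sum_distrib_left)
  also have "\<dots> = 0"
    using deg zero by (intro sum.neutral) auto
  finally show ?thesis
    using \<open>finite S\<close> by (auto simp: q_def poly_prod prod_zero_iff)
qed

section \<open>Pairwise products of a decreasing sequence\<close>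

text \<open>Sorted pairs represent unordered ones, in the order used by
  \<open>collision_free_in_frequency\<close>.\<close>

definition triangle :: "nat \<Rightarrow> (nat \<times> nat) set" where
  "triangle n = {(j, k). k \<le> j \<and> j \<le> n}"

definition pair_products :: "nat \<Rightarrow> (nat \<Rightarrow> real) \<Rightarrow> real set" where
  "pair_products n \<alpha> = (\<lambda>(j, k). \<alpha> j * \<alpha> k) ` triangle n"

lemma triangle_eq_Sigma: "triangle n = (SIGMA j:{..n}. {..j})"
  by (auto simp: triangle_def)

lemma finite_pair_products: "finite (pair_products n \<alpha>)"
  by (simp add: pair_products_def triangle_eq_Sigma)

text \<open>Two sets of products together thus have at most \<open>(n + 1) * (n + 2)\<close>
  elements, which is where the number \<open>L\<close> of samples comes from.\<close>

lemma card_pair_products: "2 * card (pair_products n \<alpha>) \<le> (n + 1) * (n + 2)"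
proof -
  have "2 * card (triangle n) = (n + 1) * (n + 2)"
    by (induction n) (auto simp: triangle_eq_Sigma card_SigmaI)
  moreover have "card (pair_products n \<alpha>) \<le> card (triangle n)"
    unfolding pair_products_def by (rule card_image_le) (simp add: triangle_eq_Sigma)
  ultimately show ?thesis by linarith
qed

lemma pair_productsI: "j \<le> n \<Longrightarrow> k \<le> n \<Longrightarrow> \<alpha> j * \<alpha> k \<in> pair_products n \<alpha>"
  unfolding pair_products_def triangle_def
  by (rule image_eqI[of _ _ "(max j k, min j k)"]) (auto simp: max_def min_def)

lemma pair_productsE:
  assumes "p \<in> pair_products n \<alpha>"
  obtains j k where "k \<le> j" "j \<le> n" "p = \<alpha> j * \<alpha> k"
  using assms by (auto simp: pair_products_def triangle_def)

definition decreasing_collision_free :: "nat \<Rightarrow> (nat \<Rightarrow> real) \<Rightarrow> bool" where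
  "decreasing_collision_free n \<alpha> \<longleftrightarrow>
     (\<forall>k\<le>n. 0 < \<alpha> k) \<and> (\<forall>j k. j < k \<longrightarrow> k \<le> n \<longrightarrow> \<alpha> k < \<alpha> j) \<and>
     inj_on (\<lambda>(j, k). \<alpha> j * \<alpha> k) (triangle n)"

lemma decreasing_collision_free_mono:
  "decreasing_collision_free n \<alpha> \<Longrightarrow> j \<le> k \<Longrightarrow> k \<le> n \<Longrightarrow> \<alpha> k \<le> \<alpha> j"
  by (cases "j = k") (auto simp: decreasing_collision_free_def less_imp_le)

text \<open>Sorting both pairs with \<open>max\<close> and \<open>min\<close> keeps the products and
  moves the pairs into \<open>triangle n\<close>, where the products are injective.\<close>

lemma pair_product_eq_iff:
  assumes \<alpha>: "decreasing_collision_free n \<alpha>" and "j \<le> n" "k \<le> n" "j' \<le> n" "k' \<le> n"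
  shows "\<alpha> j' * \<alpha> k' = \<alpha> j * \<alpha> k \<longleftrightarrow> (j' = j \<and> k' = k) \<or> (j' = k \<and> k' = j)"
proof
  assume eq: "\<alpha> j' * \<alpha> k' = \<alpha> j * \<alpha> k"
  have inj: "inj_on (\<lambda>(j, k). \<alpha> j * \<alpha> k) (triangle n)"
    using \<alpha> by (simp add: decreasing_collision_free_def)
  have "\<alpha> (max j' k') * \<alpha> (min j' k') = \<alpha> j' * \<alpha> k'" for j' k' :: nat
    by (auto simp: max_def min_def)
  with eq have "(\<lambda>(j, k). \<alpha> j * \<alpha> k) (max j' k', min j' k') = (\<lambda>(j, k). \<alpha> j * \<alpha> k) (max j k, min j k)"
    by simp
  then have "(max j' k', min j' k') = (max j k, min j k)"
    by (rule inj_onD[OF inj]) (use assms in \<open>auto simp: triangle_def\<close>)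
  then show "(j' = j \<and> k' = k) \<or> (j' = k \<and> k' = j)"
    by (auto simp: max_def min_def split: if_splits)
qed auto

text \<open>The largest product that does not involve only the indices up to \<open>m\<close> is
  \<open>\<alpha> 0 * \<alpha> (m + 1)\<close>, so the values can be read off from the set of products one after the other.\<close>

lemma pair_products_step:
  assumes \<alpha>: "decreasing_collision_free n \<alpha>" and \<beta>: "decreasing_collision_free n \<beta>"
    and sub: "pair_products n \<alpha> \<subseteq> pair_products n \<beta>"
    and eq: "\<And>i. i < m \<Longrightarrow> \<alpha> i = \<beta> i" and m: "m \<le> n"
  shows "\<alpha> 0 * \<alpha> m \<le> \<beta> 0 * \<beta> m"
proof -
  have "\<alpha> 0 * \<alpha> m \<in> pair_products n \<beta>"
    using sub pair_productsI[of 0 n m \<alpha>] m by auto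
  then obtain j k where jk: "k \<le> j" "j \<le> n" "\<alpha> 0 * \<alpha> m = \<beta> j * \<beta> k"
    by (rule pair_productsE)
  \<comment> \<open>Otherwise both indices lie below \<open>m\<close>, where the sequences agree,
    and \<open>\<alpha> 0 * \<alpha> m\<close> would collide with
    \<open>\<alpha> j * \<alpha> k\<close>.\<close>
  have "m \<le> j"
  proof (rule ccontr)
    assume "\<not> m \<le> j"
    then have "\<alpha> 0 * \<alpha> m = \<alpha> j * \<alpha> k"
      using jk eq by simp
    then show False
      using pair_product_eq_iff[OF \<alpha>, of j k 0 m] jk m \<open>\<not> m \<le> j\<close> by auto
  qed
  then have "\<beta> j * \<beta> k \<le> \<beta> m * \<beta> 0"
    using jk \<beta> by (intro mult_mono decreasing_collision_free_mono[OF \<beta>])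
      (auto simp: decreasing_collision_free_def less_imp_le)
  then show ?thesis
    using jk by (simp add: mult.commute)
qed

text \<open>By strong induction, the previous bound in both directions gives
  \<open>\<alpha> 0 * \<alpha> m = \<beta> 0 * \<beta> m\<close>. For \<open>m = 0\<close> a
  positive square root is taken; later the common first factor cancels.\<close>

lemma pair_products_determine:
  assumes \<alpha>: "decreasing_collision_free n \<alpha>" and \<beta>: "decreasing_collision_free n \<beta>"
    and eq: "pair_products n \<alpha> = pair_products n \<beta>" and "m \<le> n"
  shows "\<alpha> m = \<beta> m"
  using \<open>m \<le> n\<close>
proof (induction m rule: less_induct)
  case (less m)
  have pos: "0 < \<alpha> 0" "0 < \<beta> 0" "0 < \<alpha> m" "0 < \<beta> m"
    using \<alpha> \<beta> less.prems by (auto simp: decreasing_collision_free_def)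
  have "\<alpha> 0 * \<alpha> m \<le> \<beta> 0 * \<beta> m" "\<beta> 0 * \<beta> m \<le> \<alpha> 0 * \<alpha> m"
    using less pair_products_step[OF \<alpha> \<beta>, of m] pair_products_step[OF \<beta> \<alpha>, of m] eq by auto
  then have prod: "\<alpha> 0 * \<alpha> m = \<beta> 0 * \<beta> m" by simp
  show ?case
  proof (cases "m = 0")
    case True
    then have "(\<alpha> 0)\<^sup>2 = (\<beta> 0)\<^sup>2"
      using prod by (simp add: power2_eq_square)
    then show ?thesis
      using pos True by (simp add: power2_eq_iff_nonneg)
  next
    case False
    then have "\<alpha> 0 = \<beta> 0"
      using less by simp
    then show ?thesis
      using prod pos by simp
  qed
qed

section \<open>The squared exponential sum and its coefficients\<close>

text \<open>The pairs are ordered, so a mixed product is counted twice. Allowing every real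
  \<open>p\<close>, with value 0 off the products, lets two sequences be compared over one index
  set.\<close>

definition square_coeff :: "nat \<Rightarrow> (nat \<Rightarrow> real) \<Rightarrow> (nat \<Rightarrow> real) \<Rightarrow> real \<Rightarrow> real" where
  "square_coeff n \<alpha> c p = (\<Sum>(j, k) \<in> {(j, k). j \<le> n \<and> k \<le> n \<and> \<alpha> j * \<alpha> k = p}. c j * c k)"

lemma square_exponential_sum:
  assumes "finite S" "pair_products n \<alpha> \<subseteq> S"
  shows "(\<Sum>k\<le>n. c k * \<alpha> k ^ l)\<^sup>2 = (\<Sum>p\<in>S. square_coeff n \<alpha> c p * p ^ l)"
proof -
  have "(\<Sum>k\<le>n. c k * \<alpha> k ^ l)\<^sup>2 = (\<Sum>(j, k)\<in>{..n} \<times> {..n}. c j * c k * (\<alpha> j * \<alpha> k) ^ l)"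
    by (simp add: power2_eq_square sum_product sum.cartesian_product power_mult_distrib mult_ac)
  also have "\<dots> = (\<Sum>p\<in>S. \<Sum>(j, k)\<in>{jk \<in> {..n} \<times> {..n}. (\<lambda>(j, k). \<alpha> j * \<alpha> k) jk = p}.
      c j * c k * (\<alpha> j * \<alpha> k) ^ l)"
    by (rule sum.group[symmetric]) (use assms in \<open>auto dest: subsetD[OF _ pair_productsI]\<close>)
  also have "\<dots> = (\<Sum>p\<in>S. square_coeff n \<alpha> c p * p ^ l)"
    unfolding square_coeff_def sum_distrib_right
    by (intro sum.cong) auto
  finally show ?thesis .
qed

lemma square_coeff_outside: "p \<notin> pair_products n \<alpha> \<Longrightarrow> square_coeff n \<alpha> c p = 0"
  unfolding square_coeff_def by (rule sum.neutral) (auto simp: pair_productsI)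

lemma square_coeff_pair_product:
  assumes "decreasing_collision_free n \<alpha>" "j \<le> n" "k \<le> n"
  shows "square_coeff n \<alpha> c (\<alpha> j * \<alpha> k) = (if j = k then 1 else 2) * (c j * c k)"
proof -
  have "{(j', k'). j' \<le> n \<and> k' \<le> n \<and> \<alpha> j' * \<alpha> k' = \<alpha> j * \<alpha> k} = {(j, k), (k, j)}"
    using pair_product_eq_iff[OF assms(1)] assms(2,3) by auto
  then show ?thesis
    by (simp add: square_coeff_def)
qed

lemma square_exponential_sum_determines:
  assumes \<alpha>: "decreasing_collision_free n \<alpha>" and \<beta>: "decreasing_collision_free n \<beta>"
    and b: "\<And>k. k \<le> n \<Longrightarrow> b k \<noteq> 0" and c: "\<And>k. k \<le> n \<Longrightarrow> c k \<noteq> 0"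
    and samples: "\<And>l. l < (n + 1) * (n + 2) \<Longrightarrow>
      \<bar>\<Sum>k\<le>n. b k * \<alpha> k ^ l\<bar> = \<bar>\<Sum>k\<le>n. c k * \<beta> k ^ l\<bar>"
  shows "\<forall>k\<le>n. \<alpha> k = \<beta> k" and "\<exists>s\<in>{1, - 1}. \<forall>k\<le>n. c k = s * b k"
proof -
  define S where "S = pair_products n \<alpha> \<union> pair_products n \<beta>"
  have fin: "finite S"
    by (simp add: S_def finite_pair_products)
  have card: "card S \<le> (n + 1) * (n + 2)"
    using card_Un_le[of "pair_products n \<alpha>" "pair_products n \<beta>"]
      card_pair_products[of n \<alpha>] card_pair_products[of n \<beta>] unfolding S_def by linarith
  \<comment> \<open>The difference of the squared sums has at most \<open>card S\<close>
    exponentials and vanishes at as many exponents.\<close>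
  have coeff_S: "square_coeff n \<alpha> b p - square_coeff n \<beta> c p = 0" if "p \<in> S" for p
  proof (rule power_sums_zero_imp_coeffs_zero[OF fin _ that])
    fix l assume "l < card S"
    then have "(\<Sum>k\<le>n. b k * \<alpha> k ^ l)\<^sup>2 = (\<Sum>k\<le>n. c k * \<beta> k ^ l)\<^sup>2"
      using samples[of l] card by (simp add: abs_eq_iff power2_eq_iff)
    then show "(\<Sum>p\<in>S. (square_coeff n \<alpha> b p - square_coeff n \<beta> c p) * p ^ l) = 0"
      using square_exponential_sum[OF fin, of n \<alpha> b l] square_exponential_sum[OF fin, of n \<beta> c l]
      by (simp add: S_def left_diff_distrib sum_subtractf)
  qed
  have coeff: "square_coeff n \<alpha> b p = square_coeff n \<beta> c p" for p
  proof (cases "p \<in> S")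
    case True
    then show ?thesis using coeff_S by simp
  next
    case False
    then show ?thesis by (simp add: S_def square_coeff_outside)
  qed
  \<comment> \<open>Each coefficient at a product is once or twice a product of nonzero numbers, so
    the set of products is exactly the support of the coefficients.\<close>
  have products: "p \<in> pair_products n \<gamma> \<longleftrightarrow> square_coeff n \<gamma> e p \<noteq> 0"
    if "decreasing_collision_free n \<gamma>" "\<And>k. k \<le> n \<Longrightarrow> e k \<noteq> 0" for \<gamma> e p
  proof
    assume "p \<in> pair_products n \<gamma>"
    then show "square_coeff n \<gamma> e p \<noteq> 0"
      by (rule pair_productsE) (simp add: square_coeff_pair_product that)
  qed (use square_coeff_outside in blast)
  have "pair_products n \<alpha> = pair_products n \<beta>"
    using products[OF \<alpha> b] products[OF \<beta> c] coeff by auto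
  then show eq: "\<forall>k\<le>n. \<alpha> k = \<beta> k"
    using pair_products_determine[OF \<alpha> \<beta>] by auto
  have prod_eq: "b j * b k = c j * c k" if "j \<le> n" "k \<le> n" for j k
    using coeff[of "\<alpha> j * \<alpha> k"] square_coeff_pair_product[OF \<alpha> that, of b]
      square_coeff_pair_product[OF \<beta> that, of c] eq that by (auto split: if_splits)
  then have "(c 0)\<^sup>2 = (b 0)\<^sup>2"
    by (simp add: power2_eq_square)
  then have "c 0 = 1 * b 0 \<or> c 0 = - 1 * b 0"
    by (simp add: power2_eq_iff)
  then obtain s where s: "s \<in> {1, - 1}" "c 0 = s * b 0"
    by blast
  \<comment> \<open>Cancel \<open>b 0\<close> in \<open>b 0 * b k = s * b 0 * c k\<close>;
    \<open>s\<close> is its own inverse.\<close>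
  have "c k = s * b k" if "k \<le> n" for k
    using prod_eq[of 0 k] that s b[of 0] by auto
  then show "\<exists>s\<in>{1, - 1}. \<forall>k\<le>n. c k = s * b k"
    using s(1) by auto
qed

subsection \<open>The discrete Fourier transform of real vectors\<close>

definition unit_root :: "nat \<Rightarrow> int \<Rightarrow> complex" where
  "unit_root d k = cis (2 * pi * of_int k / of_nat d)"

lemma unit_root_0 [simp]: "unit_root d 0 = 1"
  by (simp add: unit_root_def)

lemma unit_root_add: "unit_root d (j + k) = unit_root d j * unit_root d k"
  by (simp add: unit_root_def cis_mult distrib_left add_divide_distrib)

lemma cnj_unit_root: "cnj (unit_root d k) = unit_root d (- k)"
  by (simp add: unit_root_def cis_cnj)

lemma unit_root_power: "unit_root d k ^ m = unit_root d (k * int m)"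
  by (induction m) (auto simp: unit_root_add[symmetric] algebra_simps)

lemma unit_root_eq_1_iff:
  assumes "d > 0"
  shows "unit_root d k = 1 \<longleftrightarrow> int d dvd k"
proof -
  have "cis t = 1 \<longleftrightarrow> cos t = 1" for t
    by (auto simp: complex_eq_iff cos_one_sin_zero)
  then have "unit_root d k = 1 \<longleftrightarrow> (\<exists>n. 2 * pi * of_int k / of_nat d = of_int n * 2 * pi)"
    unfolding unit_root_def by (simp add: cos_one_2pi_int)
  also have "\<dots> \<longleftrightarrow> (\<exists>n. real_of_int k = of_int (int d * n))"
    using assms by (simp add: field_simps)
  also have "\<dots> \<longleftrightarrow> int d dvd k"
    unfolding of_int_eq_iff by (auto simp: dvd_def)
  finally show ?thesis .
qed

lemma unit_root_cong:
  assumes "d > 0" "j mod int d = k mod int d"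
  shows "unit_root d j = unit_root d k"
proof -
  have "int d dvd j - k"
    using assms(2) by (simp add: mod_eq_dvd_iff)
  then show ?thesis
    using unit_root_add[of d "j - k" k] unit_root_eq_1_iff[OF assms(1), of "j - k"] by simp
qed

text \<open>A geometric sum whose ratio is a \<open>d\<close>-th root of unity: it vanishes unless
  the ratio is 1.\<close>

lemma sum_unit_root:
  assumes "d > 0"
  shows "(\<Sum>k<d. unit_root d (m * int k)) = (if int d dvd m then of_nat d else 0)"
proof (cases "int d dvd m")
  case True
  then have "unit_root d (m * int k) = 1" for k
    by (simp add: unit_root_eq_1_iff[OF assms])
  then show ?thesis
    using True by simp
next
  case False
  have "unit_root d m ^ d = 1"
    using assms by (simp add: unit_root_power unit_root_eq_1_iff)
  then show ?thesis
    using False sum_gp_strict[of "unit_root d m" d]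
    by (simp add: unit_root_power unit_root_eq_1_iff[OF assms])
qed

section \<open>Symmetry, Parseval's identity and inversion\<close>

text \<open>Periodicity of \<open>unit_root\<close> absorbs the reduction of the index modulo
  \<open>d\<close>, leaving a sum valid for every integer \<open>k\<close>.\<close>

lemma fourier_coeff_eq_sum:
  assumes "v \<in> carrier_vec d" "d > 0"
  shows "fourier_coeff v k = (\<Sum>m<d. of_real (v $ m) * unit_root d (- (k * int m)))"
proof -
  define k' where "k' = nat (k mod int d)"
  have k': "k' < d" "int k' = k mod int d"
    using assms by (auto simp: k'_def nat_less_iff)
  have "fourier_coeff v k =
      (\<Sum>m<d. exp (- 2 * of_real pi * \<i> * of_nat k' * of_nat m / of_nat d) * of_real (v $ m))"
    using assms k'(1) unfolding fourier_coeff_def dft_def dft_mat_def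
    by (simp add: k'_def[symmetric] scalar_prod_def atLeast0LessThan)
  also have "\<dots> = (\<Sum>m<d. of_real (v $ m) * unit_root d (- (k * int m)))"
  proof (rule sum.cong)
    fix m
    have "unit_root d (- (k * int m)) = unit_root d (- (int k' * int m))"
      by (intro unit_root_cong[OF \<open>d > 0\<close>] mod_minus_cong mod_mult_cong) (simp_all add: k'(2))
    then show "exp (- 2 * of_real pi * \<i> * of_nat k' * of_nat m / of_nat d) * of_real (v $ m) =
        of_real (v $ m) * unit_root d (- (k * int m))"
      by (simp add: unit_root_def cis_conv_exp mult_ac)
  qed simp
  finally show ?thesis .
qed

lemma fourier_coeff_cong:
  assumes "v \<in> carrier_vec d" "j mod int d = k mod int d"
  shows "fourier_coeff v j = fourier_coeff v k"
  using assms by (simp add: fourier_coeff_def)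

lemma fourier_coeff_uminus:
  assumes "v \<in> carrier_vec d" "d > 0"
  shows "fourier_coeff v (- k) = cnj (fourier_coeff v k)"
  by (simp add: fourier_coeff_eq_sum[OF assms] cnj_unit_root)

text \<open>Here \<open>k\<close> and \<open>- k\<close> agree modulo \<open>d\<close>, so the
  coefficient is its own conjugate. This covers frequency 0 and, for even \<open>d\<close>,
  frequency \<open>d div 2\<close>.\<close>

lemma fourier_coeff_real:
  assumes "v \<in> carrier_vec d" "d > 0" "int d dvd 2 * k"
  shows "fourier_coeff v k \<in> \<real>"
proof -
  have "fourier_coeff v (- k) = fourier_coeff v k"
    using assms by (intro fourier_coeff_cong[OF assms(1)]) (simp add: mod_eq_dvd_iff)
  then show ?thesis
    using fourier_coeff_uminus[OF assms(1,2), of k] by (simp add: complex_is_Real_iff complex_eq_iff)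
qed

text \<open>With the sum over frequencies moved innermost, orthogonality of the characters leaves
  only the diagonal \<open>m = l\<close>.\<close>

lemma parseval:
  assumes v: "v \<in> carrier_vec d" and w: "w \<in> carrier_vec d" and "d > 0"
  shows "(\<Sum>k<d. cnj (fourier_coeff v (int k)) * fourier_coeff w (int k)) = of_nat d * of_real (v \<bullet> w)"
proof -
  have "(\<Sum>k<d. cnj (fourier_coeff v (int k)) * fourier_coeff w (int k)) =
      (\<Sum>k<d. \<Sum>m<d. \<Sum>l<d. of_real (v $ m * w $ l) * unit_root d ((int m - int l) * int k))"
    unfolding fourier_coeff_eq_sum[OF v \<open>d > 0\<close>] fourier_coeff_eq_sum[OF w \<open>d > 0\<close>] cnj_sum sum_product
    by (intro sum.cong refl) (simp add: cnj_unit_root unit_root_add[symmetric] algebra_simps)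
  also have "\<dots> = (\<Sum>m<d. \<Sum>l<d. of_real (v $ m * w $ l) * (\<Sum>k<d. unit_root d ((int m - int l) * int k)))"
    unfolding sum_distrib_left by (subst sum.swap, rule sum.cong[OF refl], rule sum.swap)
  also have "\<dots> = (\<Sum>m<d. \<Sum>l<d. if m = l then of_nat d * of_real (v $ m * w $ l) else 0)"
  proof (intro sum.cong refl)
    fix m l assume "m \<in> {..<d}" "l \<in> {..<d}"
    then have "int d dvd int m - int l \<longleftrightarrow> m = l"
      by (simp flip: mod_eq_dvd_iff)
    then show "of_real (v $ m * w $ l) * (\<Sum>k<d. unit_root d ((int m - int l) * int k)) =
        (if m = l then of_nat d * of_real (v $ m * w $ l) else 0)"
      by (simp add: sum_unit_root[OF \<open>d > 0\<close>])
  qed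
  also have "\<dots> = of_nat d * of_real (v \<bullet> w)"
    using w by (simp add: scalar_prod_def atLeast0LessThan sum_distrib_left)
  finally show ?thesis .
qed

lemma fourier_coeff_smult:
  assumes "v \<in> carrier_vec d" "d > 0"
  shows "fourier_coeff (s \<cdot>\<^sub>v v) k = of_real s * fourier_coeff v k"
proof -
  have "s \<cdot>\<^sub>v v \<in> carrier_vec d"
    using assms by simp
  then show ?thesis
    using assms by (simp add: fourier_coeff_eq_sum[of _ d] sum_distrib_left mult.assoc)
qed

text \<open>Parseval's identity against the unit vectors reads off each entry.\<close>

lemma fourier_coeff_inject:
  assumes v: "v \<in> carrier_vec d" and w: "w \<in> carrier_vec d" and "d > 0"
    and eq: "\<And>k. k < d \<Longrightarrow> fourier_coeff v (int k) = fourier_coeff w (int k)"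
  shows "v = w"
proof (rule eq_vecI)
  fix i assume "i < dim_vec w"
  then have i: "i < d"
    using w by simp
  have "complex_of_nat d * of_real (unit_vec d i \<bullet> v) = of_nat d * of_real (unit_vec d i \<bullet> w)"
    unfolding parseval[OF unit_vec_carrier v \<open>d > 0\<close>, symmetric]
      parseval[OF unit_vec_carrier w \<open>d > 0\<close>, symmetric]
    using eq by (intro sum.cong) auto
  then show "v $ i = w $ i"
    using v w i \<open>d > 0\<close> by simp
qed (use v w in simp)

section \<open>Circulant matrices act diagonally in frequency\<close>

lemma circ_carrier: "a \<in> carrier_vec d \<Longrightarrow> circ a \<in> carrier_mat d d"
  by (auto simp: circ_def)

lemma fourier_coeff_circ:
  assumes a: "a \<in> carrier_vec d" and v: "v \<in> carrier_vec d" and "d > 0"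
  shows "fourier_coeff (circ a *\<^sub>v v) k = fourier_coeff a k * fourier_coeff v k"
proof -
  have cv: "circ a *\<^sub>v v \<in> carrier_vec d"
    using circ_carrier[OF a] v by simp
  have "fourier_coeff (circ a *\<^sub>v v) k =
      (\<Sum>i<d. \<Sum>j<d. of_real (a $ nat ((int i - int j) mod int d) * v $ j) * unit_root d (- (k * int i)))"
    using a v unfolding fourier_coeff_eq_sum[OF cv \<open>d > 0\<close>]
    by (intro sum.cong refl) (simp add: circ_def scalar_prod_def atLeast0LessThan sum_distrib_right)
  also have "\<dots> = (\<Sum>j<d. \<Sum>i<d. of_real (a $ nat ((int i - int j) mod int d) * v $ j) * unit_root d (- (k * int i)))"
    by (rule sum.swap)
  also have "\<dots> = (\<Sum>j<d. of_real (v $ j) * unit_root d (- (k * int j)) * fourier_coeff a k)"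
  proof (intro sum.cong refl)
    fix j assume "j \<in> {..<d}"
    then have j: "j < d" by simp
    have "(\<Sum>i<d. of_real (a $ nat ((int i - int j) mod int d) * v $ j) * unit_root d (- (k * int i))) =
        (\<Sum>m<d. of_real (a $ m * v $ j) * unit_root d (- (k * (int m + int j))))"
    \<comment> \<open>The convolution theorem rests on the substitution \<open>m = i - j\<close>
      modulo \<open>d\<close>, whose inverse is the shift by \<open>j\<close>.\<close>
    proof (rule sum.reindex_bij_witness[where i = "\<lambda>m. nat ((int m + int j) mod int d)"
          and j = "\<lambda>i. nat ((int i - int j) mod int d)"])
      fix i assume "i \<in> {..<d}"
      have nn: "0 \<le> z mod int d" for z
        using \<open>d > 0\<close> by simp
      show "nat ((int (nat ((int i - int j) mod int d)) + int j) mod int d) = i"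
        using \<open>i \<in> {..<d}\<close> nn by (simp add: mod_add_left_eq)
      show "nat ((int (nat ((int i + int j) mod int d)) - int j) mod int d) = i"
        using \<open>i \<in> {..<d}\<close> nn by (simp add: mod_diff_left_eq)
      show "nat ((int i - int j) mod int d) \<in> {..<d}" "nat ((int i + int j) mod int d) \<in> {..<d}"
        using \<open>d > 0\<close> by (auto simp: nat_less_iff)
      have "unit_root d (- (k * (int (nat ((int i - int j) mod int d)) + int j))) = unit_root d (- (k * int i))"
      proof (rule unit_root_cong[OF \<open>d > 0\<close>], rule mod_minus_cong, rule mod_mult_cong[OF refl])
        show "(int (nat ((int i - int j) mod int d)) + int j) mod int d = int i mod int d"
          using nn by (simp add: mod_add_left_eq)
      qed
      then show "of_real (a $ nat ((int i - int j) mod int d) * v $ j) *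
          unit_root d (- (k * (int (nat ((int i - int j) mod int d)) + int j))) =
          of_real (a $ nat ((int i - int j) mod int d) * v $ j) * unit_root d (- (k * int i))"
        by simp
    qed
    also have "\<dots> = of_real (v $ j) * unit_root d (- (k * int j)) * fourier_coeff a k"
      unfolding fourier_coeff_eq_sum[OF a \<open>d > 0\<close>] sum_distrib_left
      by (intro sum.cong refl) (simp add: unit_root_add[symmetric] algebra_simps)
    finally show "(\<Sum>i<d. of_real (a $ nat ((int i - int j) mod int d) * v $ j) * unit_root d (- (k * int i))) =
        of_real (v $ j) * unit_root d (- (k * int j)) * fourier_coeff a k" .
  qed
  also have "\<dots> = fourier_coeff a k * fourier_coeff v k"
    by (simp add: fourier_coeff_eq_sum[OF v \<open>d > 0\<close>] sum_distrib_left mult.commute)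
  finally show ?thesis .
qed

lemma fourier_coeff_circ_power:
  assumes a: "a \<in> carrier_vec d" and "v \<in> carrier_vec d" and "d > 0"
  shows "fourier_coeff (circ a ^\<^sub>m l *\<^sub>v v) k = fourier_coeff a k ^ l * fourier_coeff v k"
  using \<open>v \<in> carrier_vec d\<close>
proof (induction l arbitrary: v)
  case 0
  then show ?case
    using circ_carrier[OF a] by simp
next
  case (Suc l)
  have "circ a ^\<^sub>m Suc l *\<^sub>v v = circ a ^\<^sub>m l *\<^sub>v (circ a *\<^sub>v v)"
    using circ_carrier[OF a] Suc.prems by (simp add: assoc_mult_mat_vec[of _ d d _ d])
  moreover have "circ a *\<^sub>v v \<in> carrier_vec d"
    using circ_carrier[OF a] Suc.prems by simp
  ultimately show ?case
    using Suc fourier_coeff_circ[OF a Suc.prems \<open>d > 0\<close>] by (simp add: mult_ac)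
qed

text \<open>The number of frequencies modulo \<open>d\<close> that are congruent to \<open>k\<close> or \<open>- k\<close>.\<close>

definition fold_weight :: "nat \<Rightarrow> nat \<Rightarrow> nat" where
  "fold_weight d k = card {m \<in> {..<d}. min m (d - m) = k}"

lemma fold_weight_pos: "d > 0 \<Longrightarrow> k \<le> d div 2 \<Longrightarrow> fold_weight d k > 0"
proof -
  assume "d > 0" "k \<le> d div 2"
  then have "k \<in> {m \<in> {..<d}. min m (d - m) = k}"
    by auto
  then show ?thesis
    by (auto simp: fold_weight_def card_gt_0_iff)
qed

text \<open>The indices are grouped by \<open>min m (d - m)\<close>, their distance to 0 modulo
  \<open>d\<close>; the symmetry makes \<open>t\<close> constant on each group.\<close>

lemma sum_fold:
  fixes t :: "nat \<Rightarrow> real"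
  assumes "d > 0" and sym: "\<And>k. 0 < k \<Longrightarrow> k < d \<Longrightarrow> t (d - k) = t k"
  shows "(\<Sum>k<d. t k) = (\<Sum>k\<le>d div 2. of_nat (fold_weight d k) * t k)"
proof -
  have "(\<Sum>k<d. t k) = (\<Sum>k\<le>d div 2. \<Sum>m\<in>{m \<in> {..<d}. min m (d - m) = k}. t m)"
    by (rule sum.group[symmetric]) auto
  also have "\<dots> = (\<Sum>k\<le>d div 2. \<Sum>m\<in>{m \<in> {..<d}. min m (d - m) = k}. t k)"
  proof (intro sum.cong refl)
    fix k m assume m: "m \<in> {m \<in> {..<d}. min m (d - m) = k}"
    then show "t m = t k"
      \<comment> \<open>If \<open>m\<close> exceeds \<open>d - m\<close>, then \<open>m\<close> is
        positive and \<open>k = d - m\<close>; otherwise \<open>k = m\<close>.\<close>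
      using sym[of m] by (cases "m \<le> d - m") auto
  qed
  finally show ?thesis
    by (simp add: fold_weight_def)
qed

section \<open>Samples as exponential sums over half of the spectrum\<close>

definition sample_coeff :: "nat \<Rightarrow> real vec \<Rightarrow> real vec \<Rightarrow> nat \<Rightarrow> real" where
  "sample_coeff d x \<phi> k =
     of_nat (fold_weight d k) * Re (cnj (fourier_coeff x (int k)) * fourier_coeff \<phi> (int k))"

text \<open>Parseval's identity moves the inner product to frequency, where the circulant multiplies
  by real numbers. The real parts of the terms at \<open>k\<close> and \<open>d - k\<close> coincide
  because these frequencies are conjugate, so the sum folds.\<close>

lemma sample_eq_exponential_sum:
  assumes a: "a \<in> carrier_vec d" and x: "x \<in> carrier_vec d" and \<phi>: "\<phi> \<in> carrier_vec d"
    and d: "d > 0" and dec: "strictly_symmetrically_decreasing a"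
  shows "of_nat d * (x \<bullet> (circ a ^\<^sub>m l *\<^sub>v \<phi>)) =
    (\<Sum>k\<le>d div 2. sample_coeff d x \<phi> k * Re (fourier_coeff a (int k)) ^ l)"
proof -
  define t where
    "t k = Re (fourier_coeff a (int k)) ^ l * Re (cnj (fourier_coeff x (int k)) * fourier_coeff \<phi> (int k))" for k
  have w: "circ a ^\<^sub>m l *\<^sub>v \<phi> \<in> carrier_vec d"
    using circ_carrier[OF a] \<phi> by (simp add: mult_mat_vec_carrier[of _ d d])
  have real: "fourier_coeff a k = of_real (Re (fourier_coeff a k))" for k
    using dec by (simp add: strictly_symmetrically_decreasing_def)
  have "of_nat d * (x \<bullet> (circ a ^\<^sub>m l *\<^sub>v \<phi>)) =
      Re (\<Sum>k<d. cnj (fourier_coeff x (int k)) * fourier_coeff (circ a ^\<^sub>m l *\<^sub>v \<phi>) (int k))"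
    unfolding parseval[OF x w d] by simp
  also have "\<dots> = (\<Sum>k<d. t k)"
    unfolding Re_sum
  proof (intro sum.cong refl)
    fix k
    have "cnj (fourier_coeff x (int k)) * fourier_coeff (circ a ^\<^sub>m l *\<^sub>v \<phi>) (int k) =
        of_real (Re (fourier_coeff a (int k)) ^ l) * (cnj (fourier_coeff x (int k)) * fourier_coeff \<phi> (int k))"
      using real[of "int k"] by (simp add: fourier_coeff_circ_power[OF a \<phi> d])
    then show "Re (cnj (fourier_coeff x (int k)) * fourier_coeff (circ a ^\<^sub>m l *\<^sub>v \<phi>) (int k)) = t k"
      by (simp only: t_def Re_complex_of_real times_complex.sel Im_complex_of_real)
  qed
  also have "\<dots> = (\<Sum>k\<le>d div 2. of_nat (fold_weight d k) * t k)"
  proof (rule sum_fold[OF d])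
    fix k assume "0 < k" "k < d"
    then have mod: "int (d - k) mod int d = (- int k) mod int d"
      by (simp add: of_nat_diff mod_eq_dvd_iff)
    have "fourier_coeff v (int (d - k)) = cnj (fourier_coeff v (int k))" if "v \<in> carrier_vec d" for v
      unfolding fourier_coeff_cong[OF that mod] by (rule fourier_coeff_uminus[OF that d])
    then show "t (d - k) = t k"
      using a x \<phi> by (simp add: t_def)
  qed
  finally show ?thesis
    by (simp add: t_def sample_coeff_def mult_ac)
qed

subsection \<open>Recovery\<close>

lemma decreasing_collision_free_fourier_coeff:
  assumes a: "a \<in> carrier_vec d"
    and dec: "strictly_symmetrically_decreasing a" and cf: "collision_free_in_frequency a"
  shows "decreasing_collision_free (d div 2) (\<lambda>k. Re (fourier_coeff a (int k)))"
  unfolding decreasing_collision_free_def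
proof (intro conjI allI impI)
  have real: "fourier_coeff a k = of_real (Re (fourier_coeff a k))" for k
    using dec by (simp add: strictly_symmetrically_decreasing_def)
  have dim: "dim_vec a = d"
    using a by simp
  show "0 < Re (fourier_coeff a (int k))" for k
    using dec by (simp add: strictly_symmetrically_decreasing_def)
  show "Re (fourier_coeff a (int k)) < Re (fourier_coeff a (int j))" if "j < k" "k \<le> d div 2" for j k
  proof -
    have "int j \<in> {0..int (dim_vec a div 2)}" "int k \<in> {0..int (dim_vec a div 2)}" "int j < int k"
      using that unfolding dim by (auto simp: zdiv_int)
    then show ?thesis
      using dec unfolding strictly_symmetrically_decreasing_def by blast
  qed
  show "inj_on (\<lambda>(j, k). Re (fourier_coeff a (int j)) * Re (fourier_coeff a (int k))) (triangle (d div 2))"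
  proof (rule inj_onI, clarify)
    fix j k j' k'
    assume t: "(j, k) \<in> triangle (d div 2)" "(j', k') \<in> triangle (d div 2)"
      and eq: "Re (fourier_coeff a (int j)) * Re (fourier_coeff a (int k)) =
        Re (fourier_coeff a (int j')) * Re (fourier_coeff a (int k'))"
    let ?T = "{(j, k). j \<in> {0..int (dim_vec a div 2)} \<and> k \<in> {0..int (dim_vec a div 2)} \<and> j \<ge> k}"
    have inj: "inj_on (\<lambda>(j, k). fourier_coeff a j * fourier_coeff a k) ?T"
      using cf by (simp add: collision_free_in_frequency_def)
    have "fourier_coeff a (int j) * fourier_coeff a (int k) =
        fourier_coeff a (int j') * fourier_coeff a (int k')"
      using eq by (metis real of_real_mult)
    moreover have "(int j, int k) \<in> ?T" "(int j', int k') \<in> ?T"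
      using t unfolding dim triangle_def by auto
    ultimately have "(int j, int k) = (int j', int k')"
      using inj_onD[OF inj, of "(int j, int k)" "(int j', int k')"] by simp
    then show "j = j' \<and> k = k'" by simp
  qed
qed

text \<open>The real part of \<open>cnj z * u\<close> is the Euclidean inner product in the plane.
  If \<open>z\<close> were nonzero, both vectors would lie on the line orthogonal to it.\<close>

lemma cnj_mult_Re_zero_imp_zero:
  assumes indep: "independent {u, v}" "u \<noteq> v" and "Re (cnj z * u) = 0" "Re (cnj z * v) = 0"
  shows "z = 0"
proof (rule ccontr)
  assume "z \<noteq> 0"
  have nz: "u \<noteq> 0" "v \<noteq> 0"
    using indep dependent_zero by blast+
  have on_line: "\<exists>r. w = of_real r * (\<i> * z)" if "Re (cnj z * w) = 0" for w
  proof -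
    \<comment> \<open>Multiplying the purely imaginary number \<open>cnj z * w\<close> by
      \<open>z\<close> leaves \<open>w\<close> times the squared norm of \<open>z\<close>, which
      gives this factor.\<close>
    define r where "r = Im (cnj z * w) / (norm z)\<^sup>2"
    have "cnj z * w = \<i> * of_real (Im (cnj z * w))"
      using that by (simp add: complex_eq_iff)
    then have "z * cnj z * w = z * \<i> * of_real (Im (cnj z * w))"
      by (simp add: mult_ac)
    then have "of_real ((norm z)\<^sup>2) * w = z * \<i> * of_real (Im (cnj z * w))"
      by (simp only: complex_norm_square)
    then have "w = of_real r * (\<i> * z)"
      using \<open>z \<noteq> 0\<close> by (simp add: r_def field_simps)
    then show ?thesis ..
  qed
  obtain r s where r: "u = of_real r * (\<i> * z)" and s: "v = of_real s * (\<i> * z)"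
    using on_line assms by metis
  have "r \<noteq> 0"
    using nz r by auto
  then have "v = (s / r) *\<^sub>R u"
    using r s by (simp add: scaleR_conv_of_real)
  then have "v \<in> span {u}"
    by (metis span_base span_scale singletonI)
  moreover have "v \<notin> span {u}"
    using indep independent_insert[of v "{u}"] by (simp add: insert_commute)
  ultimately show False by simp
qed

theorem theorem6p3:
  fixes d L :: nat and a a' x x' \<phi>1 \<phi>2 :: "real vec"
  assumes d: "d \<ge> 1"
    and dims: "a \<in> carrier_vec d" "a' \<in> carrier_vec d" "x \<in> carrier_vec d" "x' \<in> carrier_vec d"
      "\<phi>1 \<in> carrier_vec d" "\<phi>2 \<in> carrier_vec d"
    and L: "L = (d div 2 + 1) * (d div 2 + 2)"
    and indep: "pointwise_independent d \<phi>1 \<phi>2"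
    and a: "strictly_symmetrically_decreasing a" "collision_free_in_frequency a"
    and a': "strictly_symmetrically_decreasing a'" "collision_free_in_frequency a'"
    and x: "\<forall>\<phi>\<in>{\<phi>1, \<phi>2}. \<forall>k\<in>{- int ((d - 1) div 2)..int (d div 2)}.
      Re (cnj (fourier_coeff x k) * fourier_coeff \<phi> k) \<noteq> 0"
    and x': "\<forall>\<phi>\<in>{\<phi>1, \<phi>2}. \<forall>k\<in>{- int ((d - 1) div 2)..int (d div 2)}.
      Re (cnj (fourier_coeff x' k) * fourier_coeff \<phi> k) \<noteq> 0"
    and samples: "\<forall>\<phi>\<in>{\<phi>1, \<phi>2}. \<forall>l<L.
      \<bar>scalar_prod x ((circ a ^\<^sub>m l) *\<^sub>v \<phi>)\<bar> = \<bar>scalar_prod x' ((circ a' ^\<^sub>m l) *\<^sub>v \<phi>)\<bar>"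
  shows "a' = a \<and> (x' = x \<or> x' = - x)"
proof -
  let ?n = "d div 2"
  have "d > 0"
    using d by simp
  have carrier: "\<phi> \<in> carrier_vec d" if "\<phi> \<in> {\<phi>1, \<phi>2}" for \<phi>
    using that dims by auto
  have nz: "Re (cnj (fourier_coeff x (int k)) * fourier_coeff \<phi> (int k)) \<noteq> 0"
    "Re (cnj (fourier_coeff x' (int k)) * fourier_coeff \<phi> (int k)) \<noteq> 0"
    if "\<phi> \<in> {\<phi>1, \<phi>2}" "k \<le> ?n" for \<phi> k
  proof -
    have "int k \<in> {- int ((d - 1) div 2)..int ?n}"
      using that by (auto intro: order_trans[of _ 0])
    then show "Re (cnj (fourier_coeff x (int k)) * fourier_coeff \<phi> (int k)) \<noteq> 0"
      "Re (cnj (fourier_coeff x' (int k)) * fourier_coeff \<phi> (int k)) \<noteq> 0"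
      using x x' that(1) by blast+
  qed
  have abs_eq: "\<bar>\<Sum>k\<le>?n. sample_coeff d x \<phi> k * Re (fourier_coeff a (int k)) ^ l\<bar> =
      \<bar>\<Sum>k\<le>?n. sample_coeff d x' \<phi> k * Re (fourier_coeff a' (int k)) ^ l\<bar>"
    if "\<phi> \<in> {\<phi>1, \<phi>2}" "l < (?n + 1) * (?n + 2)" for \<phi> l
  proof -
    have "\<bar>x \<bullet> (circ a ^\<^sub>m l *\<^sub>v \<phi>)\<bar> = \<bar>x' \<bullet> (circ a' ^\<^sub>m l *\<^sub>v \<phi>)\<bar>"
      using samples that unfolding L by blast
    then show ?thesis
      by (simp add: abs_mult \<open>d > 0\<close> dims a a' carrier[OF that(1)] flip: sample_eq_exponential_sum)
  qed
  have nz_coeff: "sample_coeff d x \<phi> k \<noteq> 0" "sample_coeff d x' \<phi> k \<noteq> 0"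
    if "\<phi> \<in> {\<phi>1, \<phi>2}" "k \<le> ?n" for \<phi> k
    using nz[OF that] fold_weight_pos[OF \<open>d > 0\<close> that(2)] by (simp_all add: sample_coeff_def)
  have determined: "\<forall>k\<le>?n. Re (fourier_coeff a (int k)) = Re (fourier_coeff a' (int k))"
    "\<exists>s\<in>{1, - 1}. \<forall>k\<le>?n. sample_coeff d x' \<phi> k = s * sample_coeff d x \<phi> k"
    if \<phi>: "\<phi> \<in> {\<phi>1, \<phi>2}" for \<phi>
    using square_exponential_sum_determines
      [OF decreasing_collision_free_fourier_coeff[OF dims(1) a]
        decreasing_collision_free_fourier_coeff[OF dims(2) a'] nz_coeff[OF \<phi>] abs_eq[OF \<phi>]]
    by blast+
  \<comment> \<open>A frequency \<open>k\<close> above \<open>d div 2\<close> is the conjugate of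
    the one at \<open>d - k\<close>, so half of the spectrum suffices.\<close>
  have fourier_eqI: "v = w" if v: "v \<in> carrier_vec d" and w: "w \<in> carrier_vec d"
    and eq: "\<And>k. k \<le> ?n \<Longrightarrow> fourier_coeff v (int k) = fourier_coeff w (int k)" for v w
  proof (rule fourier_coeff_inject[OF v w \<open>d > 0\<close>])
    fix k assume "k < d"
    show "fourier_coeff v (int k) = fourier_coeff w (int k)"
    proof (cases "k \<le> ?n")
      case False
      have mod: "int k mod int d = (- int (d - k)) mod int d"
        using \<open>k < d\<close> by (simp add: of_nat_diff mod_eq_dvd_iff)
      show ?thesis
        unfolding fourier_coeff_cong[OF v mod] fourier_coeff_cong[OF w mod]
          fourier_coeff_uminus[OF v \<open>d > 0\<close>] fourier_coeff_uminus[OF w \<open>d > 0\<close>]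
        using eq[of "d - k"] False by simp
    qed (use eq in simp)
  qed
  have "a = a'"
  proof (rule fourier_eqI[OF dims(1,2)])
    fix k assume "k \<le> ?n"
    then have "Re (fourier_coeff a (int k)) = Re (fourier_coeff a' (int k))"
      using determined(1)[of \<phi>1] by blast
    then show "fourier_coeff a (int k) = fourier_coeff a' (int k)"
      using a(1) a'(1) unfolding strictly_symmetrically_decreasing_def
      by (metis of_real_Re)
  qed
  have sign: "\<exists>s\<in>{1, - 1}. \<forall>k\<le>?n. Re (cnj (fourier_coeff x' (int k)) * fourier_coeff \<phi> (int k)) =
      s * Re (cnj (fourier_coeff x (int k)) * fourier_coeff \<phi> (int k))"
    if \<phi>: "\<phi> \<in> {\<phi>1, \<phi>2}" for \<phi>
  proof -
    obtain s where s: "s \<in> {1, - 1}" "\<forall>k\<le>?n. sample_coeff d x' \<phi> k = s * sample_coeff d x \<phi> k"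
      using determined(2)[OF \<phi>] by blast
    show ?thesis
    proof (intro bexI[OF _ s(1)] allI impI)
      fix k assume "k \<le> ?n"
      then have "real (fold_weight d k) * Re (cnj (fourier_coeff x' (int k)) * fourier_coeff \<phi> (int k)) =
          real (fold_weight d k) * (s * Re (cnj (fourier_coeff x (int k)) * fourier_coeff \<phi> (int k)))"
        using s(2) unfolding sample_coeff_def by (metis mult.left_commute)
      then show "Re (cnj (fourier_coeff x' (int k)) * fourier_coeff \<phi> (int k)) =
          s * Re (cnj (fourier_coeff x (int k)) * fourier_coeff \<phi> (int k))"
        using fold_weight_pos[OF \<open>d > 0\<close> \<open>k \<le> ?n\<close>] by (metis mult_left_cancel of_nat_0_less_iff order_less_irrefl)
    qed
  qed
  \<comment> \<open>At these frequencies all coefficients are real, so the real part of the product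
    factors and the nonzero coefficient of \<open>\<phi>\<close> cancels.\<close>
  have real_index: "fourier_coeff x' (int k) = of_real s * fourier_coeff x (int k)"
    if "\<phi> \<in> {\<phi>1, \<phi>2}" "k \<le> ?n" "d dvd 2 * k"
      "Re (cnj (fourier_coeff x' (int k)) * fourier_coeff \<phi> (int k)) =
        s * Re (cnj (fourier_coeff x (int k)) * fourier_coeff \<phi> (int k))" for \<phi> k s
  proof -
    have "int d dvd 2 * int k"
      using that(3) by (metis int_dvd_int_iff of_nat_mult of_nat_numeral)
    then have im: "Im (fourier_coeff v (int k)) = 0" if "v \<in> carrier_vec d" for v
      using fourier_coeff_real[OF that \<open>d > 0\<close>] by (simp add: complex_is_Real_iff)
    then show ?thesis
      using that(4) nz(1)[OF that(1,2)] dims carrier[OF that(1)] by (simp add: complex_eq_iff)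
  qed
  obtain s where s: "s \<in> {1, - 1}"
    and s1: "\<And>k. k \<le> ?n \<Longrightarrow> Re (cnj (fourier_coeff x' (int k)) * fourier_coeff \<phi>1 (int k)) =
      s * Re (cnj (fourier_coeff x (int k)) * fourier_coeff \<phi>1 (int k))"
    using sign[of \<phi>1] by blast
  obtain s' where
    s2': "\<And>k. k \<le> ?n \<Longrightarrow> Re (cnj (fourier_coeff x' (int k)) * fourier_coeff \<phi>2 (int k)) =
      s' * Re (cnj (fourier_coeff x (int k)) * fourier_coeff \<phi>2 (int k))"
    using sign[of \<phi>2] by blast
  \<comment> \<open>Both vectors recover the same coefficient of \<open>x'\<close> at frequency 0,
    and that of \<open>x\<close> is nonzero, so the signs agree.\<close>
  have "of_real s * fourier_coeff x (int 0) = of_real s' * fourier_coeff x (int 0)"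
    using real_index[of \<phi>1 0 s] real_index[of \<phi>2 0 s'] s1[of 0] s2'[of 0] by simp
  then have "s' = s"
    using nz(1)[of \<phi>1 0] by auto
  note s2 = s2'[unfolded this]
  have "x' = s \<cdot>\<^sub>v x"
  proof (rule fourier_eqI)
    fix k assume k: "k \<le> ?n"
    have "fourier_coeff x' (int k) = of_real s * fourier_coeff x (int k)"
    proof (cases "d dvd 2 * k")
      case True
      then show ?thesis
        using real_index[OF _ k _ s1[OF k]] by blast
    next
      case False
      then have "k \<noteq> 0"
        by (rule contrapos_nn) simp
      moreover have "2 * k \<noteq> d"
        using False by auto
      \<comment> \<open>Excluding 0 and, for even \<open>d\<close>, the middle frequency leaves the
        range of pointwise independence.\<close>
      ultimately have "int k \<in> {1..int ((d - 1) div 2)}"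
        using k by auto
      then have "fourier_coeff \<phi>1 (int k) \<noteq> fourier_coeff \<phi>2 (int k)"
        "independent {fourier_coeff \<phi>1 (int k), fourier_coeff \<phi>2 (int k)}"
        using indep unfolding pointwise_independent_def by blast+
      \<comment> \<open>The difference is orthogonal in the plane to two independent
        vectors.\<close>
      then have "fourier_coeff x' (int k) - of_real s * fourier_coeff x (int k) = 0"
        using s1[OF k] s2[OF k]
        by (intro cnj_mult_Re_zero_imp_zero[of "fourier_coeff \<phi>1 (int k)" "fourier_coeff \<phi>2 (int k)"])
          (simp_all add: algebra_simps)
      then show ?thesis by simp
    qed
    then show "fourier_coeff x' (int k) = fourier_coeff (s \<cdot>\<^sub>v x) (int k)"
      using fourier_coeff_smult[OF dims(3) \<open>d > 0\<close>] by simp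
  qed (use dims in auto)
  then show ?thesis
    using s \<open>a = a'\<close> by (auto simp: vec_eq_iff)
qed

end
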